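(* Let $a\in(0,\tfrac12)$. For every $E\in[0,1]$ there exists a unique $\lambda=\Lambda(E)\in[-1-a,-1+a]$ such that the $\Theta$-flow described in the context has a saddles connector going from $(0,0)$ to $(\pi,-\pi)$. Moreover, $\Lambda$ is an increasing $C^1$ function and $\frac{d\Lambda}{dE}<a$.
   Context: For $a\in(0,\tfrac12)$, $E\in[0,1]$, $\lambda\in\mathbb R$, the $\Theta$-flow is the system on the strip $[0,\pi]\times\mathbb R$ (with $\Theta$ understood mod $2\pi$ on the cylinder) $$\dot\theta=\sin\theta,\qquad \dot\Theta=-2a\sin\theta\cos\theta\cos\Theta+2aE\sin^2\theta\sin\Theta-\sin\Theta+2\lambda\sin\theta,$$ (the angular Prüfer equation of the separated Dirac equation with $\kappa=\tfrac12$, in units $m=1$). A saddles connector from $(0,0)$ to $(\pi,-\pi)$ is an orbit in $(0,\pi)\times\mathbb R$ whose $\alpha$-limit is the saddle $(0,0)$ and whose $\omega$-limit is the saddle $(\pi,-\pi)$. *)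

theory Defs
  imports "HOL-Analysis.Analysis"
begin

definition theta_field :: "real \<Rightarrow> real \<Rightarrow> real \<Rightarrow> real \<times> real \<Rightarrow> real \<times> real" where
  "theta_field a E lam p = (case p of (th, Th) \<Rightarrow>
     (sin th,
      - 2 * a * sin th * cos th * cos Th + 2 * a * E * (sin th)^2 * sin Th
      - sin Th + 2 * lam * sin th))"

definition theta_flow_solution :: "real \<Rightarrow> real \<Rightarrow> real \<Rightarrow> (real \<Rightarrow> real \<times> real) \<Rightarrow> bool" where
  "theta_flow_solution a E lam x \<longleftrightarrow>
     (\<forall>t. (x has_vector_derivative theta_field a E lam (x t)) (at t))"

definition saddles_connector :: "real \<Rightarrow> real \<Rightarrow> real \<Rightarrow> bool" where
  "saddles_connector a E lam \<longleftrightarrow>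
     (\<exists>x. theta_flow_solution a E lam x \<and>
          (\<forall>t. fst (x t) \<in> {0<..<pi}) \<and>
          (x \<longlongrightarrow> (0, 0)) at_bot \<and>
          (x \<longlongrightarrow> (pi, - pi)) at_top)"

end

theory Submission
  imports Defs
begin

text \<open>Every orbit has \<open>\<theta> = 2 arctan (exp t)\<close> up to a time shift, so a connector is a heteroclinic
  solution of one scalar equation for \<open>\<Theta>\<close>. That equation increases strictly with \<open>\<lambda>\<close> and is invariant
  under \<open>(t, \<Theta>) \<mapsto> (-t, -\<pi> - \<Theta>)\<close>, which exchanges the saddles: two connectors with different \<open>\<lambda>\<close>
  would be strictly ordered both ways, and a connector is the same as an unstable-manifold orbit with
  \<open>\<Theta> = -\<pi>/2\<close> at \<open>t = 0\<close>. In the variables \<open>x = exp t \<in> [0, 1]\<close>, \<open>v = tan (-\<Theta>/2)\<close>, \<open>\<lambda> = -1 + a m\<close>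
  the unstable manifold solves a Riccati equation \<open>(x v)' = sin \<theta> * G(m, E, x, v)\<close> and is a fixed
  point of a contraction, jointly continuous in \<open>(m, E, x)\<close>. The explicit function \<open>v = x\<close> is a
  supersolution for \<open>m = 1\<close> and a subsolution for \<open>m = E\<close>, so \<open>v = 1\<close> at \<open>x = 1\<close> for some
  \<open>m = \<mu>(E) \<in> [E, 1]\<close>.

  The difference of the solutions for \<open>E1\<close> and \<open>E2\<close> satisfies a linear equation and vanishes at both
  ends; the integrating factor \<open>J\<close> turns this into
  \<open>(\<mu>(E2) - \<mu>(E1)) \<integral> J s (1 + v2\<^sup>2) = (E2 - E1) \<integral> J s (2 s v2)\<close> with \<open>s = sin \<theta>\<close>. The resulting quotient lies
  in \<open>(0, 1)\<close> and is jointly continuous in \<open>(E1, E2)\<close>, and its diagonal is the derivative of \<open>\<mu>\<close>.\<close>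

subsection \<open>A sign lemma and a change of variable\<close>

text \<open>Beyond the last point \<open>z\<close> where \<open>f\<close> is nonnegative,
  \<open>f\<close> is negative and therefore nondecreasing, so \<open>f q\<close> is at least
  \<open>f z\<close>. Asking for the derivative only where \<open>f x < 0\<close> suits comparison
  arguments, whose estimates hold only on the wrong side of a barrier.\<close>

lemma nonneg_of_deriv_nonneg_below:
  fixes f :: "real \<Rightarrow> real"
  assumes "p \<le> q" and cont: "continuous_on {p..q} f" and "0 \<le> f p"
    and der: "\<And>x. p < x \<Longrightarrow> x < q \<Longrightarrow> f x < 0 \<Longrightarrow>
      \<exists>y. (f has_real_derivative y) (at x) \<and> 0 \<le> y"
  shows "0 \<le> f q"
proof (rule ccontr)
  assume neg: "\<not> 0 \<le> f q"
  define A where "A = {x \<in> {p..q}. 0 \<le> f x}"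
  have "closed A"
    unfolding A_def by (rule continuous_on_closed_Collect_le[OF continuous_on_const cont closed_atLeastAtMost])
  moreover have "A \<noteq> {}" "bdd_above A"
    using assms by (auto simp: A_def)
  ultimately have zA: "Sup A \<in> A"
    by (intro closed_contains_Sup) auto
  define z where "z = Sup A"
  have z: "p \<le> z" "z \<le> q" "0 \<le> f z"
    using zA by (auto simp: A_def z_def)
  have "z < q"
    using z neg by (metis le_less)
  have lt: "f x < 0" if "z < x" "x \<le> q" for x
  proof (rule ccontr)
    assume "\<not> f x < 0"
    then have "x \<in> A" using that z by (auto simp: A_def)
    then have "x \<le> z" unfolding z_def using \<open>bdd_above A\<close> by (rule cSup_upper)
    with that show False by simp
  qed
  have "f z \<le> f q"
  proof (rule DERIV_nonneg_imp_increasing_open[where f = f])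
    show "z \<le> q" by (rule z(2))
    show "continuous_on {z..q} f"
      using cont z by (auto intro: continuous_on_subset)
    show "\<exists>y. (f has_real_derivative y) (at x) \<and> 0 \<le> y" if "z < x" "x < q" for x
      using der[of x] lt[of x] that z by auto
  qed
  with z neg show False by simp
qed

text \<open>Bridge between two forms of a primitive: the integral over the fixed interval is handled
  as continuous in all parameters including \<open>x\<close>, the one over \<open>{0..x}\<close> can
  be differentiated.\<close>

lemma integral_rescale_unit:
  fixes f :: "real \<Rightarrow> real"
  assumes "continuous_on {0..1} f" "x \<in> {0..1}"
  shows "x * integral {0..1} (\<lambda>r. f (x * r)) = integral {0..x} f"
proof (cases "x = 0")
  case False
  then have x: "0 < x" "x \<le> 1" using assms by auto
  have "continuous_on {0..x} f"
    using assms(1) x by (auto intro: continuous_on_subset)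
  then have "(f has_integral integral {0..x} f) {0..x}"
    using integrable_continuous_real integrable_integral by blast
  from has_integral_stretch_real[OF this False]
  have "((\<lambda>r. f (x * r)) has_integral integral {0..x} f / x) ((\<lambda>y. y / x) ` {0..x})"
    using x by simp
  also have "(\<lambda>y. y / x) ` {0..x} = {0..1}"
    using x by (simp add: image_divide_atLeastAtMost)
  finally have "integral {0..1} (\<lambda>r. f (x * r)) = integral {0..x} f / x"
    by (rule integral_unique)
  then show ?thesis using x by simp
qed simp

definition clip :: "real \<Rightarrow> real" where
  "clip x = max 0 (min 1 x)"

lemma clip_ge_0 [simp]: "0 \<le> clip x" and clip_le_1 [simp]: "clip x \<le> 1"
  and clip_id: "0 \<le> x \<Longrightarrow> x \<le> 1 \<Longrightarrow> clip x = x"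
  by (auto simp: clip_def)

lemma continuous_on_clip [continuous_intros]:
  "continuous_on A f \<Longrightarrow> continuous_on A (\<lambda>x. clip (f x))"
  unfolding clip_def by (intro continuous_intros)

lemma clip_dist: "\<bar>clip x - clip y\<bar> \<le> \<bar>x - y\<bar>"
  by (auto simp: clip_def)

subsection \<open>The Riccati equation\<close>

text \<open>With \<open>x = exp t = tan (\<theta> / 2)\<close> these are \<open>sin \<theta>\<close> and \<open>cos \<theta>\<close>.\<close>

definition sn :: "real \<Rightarrow> real" where "sn x = 2 * x / (1 + x\<^sup>2)"
definition cs :: "real \<Rightarrow> real" where "cs x = (1 - x\<^sup>2) / (1 + x\<^sup>2)"

lemma one_plus_square_pos [simp]: "0 < 1 + (x::real)\<^sup>2" "1 + x\<^sup>2 \<noteq> 0"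
  by (simp_all add: add_pos_nonneg add_nonneg_eq_0_iff)

lemma sn_0 [simp]: "sn 0 = 0" and sn_1 [simp]: "sn 1 = 1"
  by (auto simp: sn_def)

lemma sn_nonneg: "0 \<le> x \<Longrightarrow> 0 \<le> sn x"
  by (simp add: sn_def)

lemma sn_pos: "0 < x \<Longrightarrow> 0 < sn x"
  by (simp add: sn_def)

lemma sn_le_1: "sn x \<le> 1"
proof -
  have "0 \<le> (x - 1)\<^sup>2" by simp
  then show ?thesis by (simp add: sn_def divide_le_eq_1 power2_diff)
qed

lemma sn_le_double: "0 \<le> x \<Longrightarrow> sn x \<le> 2 * x"
  by (simp add: sn_def divide_le_eq mult_le_cancel_left1)

lemma cs_nonneg: "0 \<le> x \<Longrightarrow> x \<le> 1 \<Longrightarrow> 0 \<le> cs x"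
  by (simp add: cs_def abs_square_le_1)

lemma cs_le_1: "cs x \<le> 1"
  by (simp add: cs_def)

lemma sn_cs: "(sn x)\<^sup>2 + (cs x)\<^sup>2 = 1"
proof -
  have "(2 * x)\<^sup>2 + (1 - x\<^sup>2)\<^sup>2 = (1 + x\<^sup>2)\<^sup>2"
    by (simp add: power2_eq_square algebra_simps)
  then show ?thesis
    unfolding sn_def cs_def power_divide by (simp add: add_divide_distrib[symmetric])
qed

lemma sn_mono:
  assumes "0 \<le> x" "x \<le> y" "y \<le> 1" shows "sn x \<le> sn y"
proof -
  have "x * y \<le> 1" using assms by (simp add: mult_le_one)
  then have "0 \<le> (y - x) * (1 - x * y)" using assms by simp
  then have "2 * x * (1 + y\<^sup>2) \<le> 2 * y * (1 + x\<^sup>2)"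
    by (simp add: power2_eq_square algebra_simps)
  then show ?thesis
    unfolding sn_def by (intro frac_le_eq[THEN iffD2]) (simp_all add: divide_nonpos_pos)
qed

lemma continuous_on_sn [continuous_intros]:
  "continuous_on A f \<Longrightarrow> continuous_on A (\<lambda>x. sn (f x))"
  unfolding sn_def by (intro continuous_intros) auto

lemma continuous_on_cs [continuous_intros]:
  "continuous_on A f \<Longrightarrow> continuous_on A (\<lambda>x. cs (f x))"
  unfolding cs_def by (intro continuous_intros) auto

text \<open>Along \<open>\<theta> = 2 arctan x\<close> and with \<open>\<lambda> = -1 + a m\<close>, the variable \<open>v = tan (-\<Theta> / 2)\<close>
  satisfies \<open>(x v)' = sn x * riccati a m E x v\<close>.\<close>

definition riccati :: "real \<Rightarrow> real \<Rightarrow> real \<Rightarrow> real \<Rightarrow> real \<Rightarrow> real" where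
  "riccati a m E x v = 2 * a * E * sn x * v + a * cs x * (1 - v\<^sup>2) + (1 - a * m) * (1 + v\<^sup>2)"

lemma continuous_on_riccati [continuous_intros]:
  assumes "continuous_on A m" "continuous_on A E" "continuous_on A x" "continuous_on A v"
  shows "continuous_on A (\<lambda>p. riccati a (m p) (E p) (x p) (v p))"
  unfolding riccati_def by (intro continuous_intros assms)

lemma riccati_diff:
  "riccati a m E x v - riccati a m E x w
   = (2 * a * E * sn x + (1 - a * m - a * cs x) * (v + w)) * (v - w)"
  by (simp add: riccati_def algebra_simps power2_eq_square)

locale theta_flow =
  fixes a :: real
  assumes a: "0 < a" "a < 1/2"
begin

lemma a_mult_unit: "0 \<le> x \<Longrightarrow> x \<le> 1 \<Longrightarrow> 0 \<le> a * x \<and> a * x \<le> 1/2"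
  using a mult_mono[of a "1/2" x 1] by simp

text \<open>Because \<open>a < 1/2\<close>, the three summands lie in [0, 1], [0, 1/2] and
  [0, 2].\<close>

lemma riccati_bounds:
  assumes "m \<in> {0..1}" "E \<in> {0..1}" "x \<in> {0..1}" "v \<in> {0..1}"
  shows "0 \<le> riccati a m E x v" "riccati a m E x v \<le> 4"
proof -
  have 1: "0 \<le> E * sn x * v" "E * sn x * v \<le> 1"
    using assms sn_nonneg[of x] sn_le_1[of x] by (auto intro!: mult_le_one)
  have 2: "0 \<le> cs x * (1 - v\<^sup>2)" "cs x * (1 - v\<^sup>2) \<le> 1"
    using assms cs_nonneg[of x] cs_le_1[of x]
    by (auto intro!: mult_le_one simp: power_le_one)
  have "(1 - a * m) * (1 + v\<^sup>2) \<le> 1 * 2" "0 \<le> (1 - a * m) * (1 + v\<^sup>2)"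
    using assms a_mult_unit[of m]
    by (intro mult_mono mult_nonneg_nonneg; simp add: power_le_one)+
  note 3 = this
  show "0 \<le> riccati a m E x v" "riccati a m E x v \<le> 4"
    using a_mult_unit[OF 1] a_mult_unit[OF 2] 3 by (auto simp: riccati_def algebra_simps)
qed

text \<open>This is the difference quotient of \<open>riccati\<close> in \<open>v\<close> from
  \<open>riccati_diff\<close>: the first summand is at most 1, the second is a number in [0, 1]
  times \<open>v + w\<close>. The bound 3 becomes the Lipschitz constant.\<close>

lemma riccati_slope_bounds:
  assumes "m \<in> {0..1}" "E \<in> {0..1}" "x \<in> {0..1}" "v \<in> {0..1}" "w \<in> {0..1}"
  shows "0 \<le> 2 * a * E * sn x + (1 - a * m - a * cs x) * (v + w)"
    "2 * a * E * sn x + (1 - a * m - a * cs x) * (v + w) \<le> 3"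
proof -
  have 1: "0 \<le> E * sn x" "E * sn x \<le> 1"
    using assms sn_nonneg[of x] sn_le_1[of x] by (auto intro!: mult_le_one)
  have "(1 - a * m - a * cs x) * (v + w) \<le> 1 * 2" "0 \<le> (1 - a * m - a * cs x) * (v + w)"
    using assms a_mult_unit[of m] a_mult_unit[of "cs x"] cs_nonneg[of x] cs_le_1[of x]
    by (intro mult_mono mult_nonneg_nonneg; simp)+
  note 2 = this
  show "0 \<le> 2 * a * E * sn x + (1 - a * m - a * cs x) * (v + w)"
    "2 * a * E * sn x + (1 - a * m - a * cs x) * (v + w) \<le> 3"
    using a_mult_unit[OF 1] 2 by (auto simp: algebra_simps)
qed

lemma riccati_lipschitz:
  assumes "m \<in> {0..1}" "E \<in> {0..1}" "x \<in> {0..1}"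
  shows "\<bar>riccati a m E x (clip v) - riccati a m E x (clip w)\<bar> \<le> 3 * \<bar>v - w\<bar>"
proof -
  have "\<bar>riccati a m E x (clip v) - riccati a m E x (clip w)\<bar> \<le> 3 * \<bar>clip v - clip w\<bar>"
    unfolding riccati_diff abs_mult
    using riccati_slope_bounds[OF assms, of "clip v" "clip w"]
    by (intro mult_right_mono) auto
  also have "\<dots> \<le> 3 * \<bar>v - w\<bar>"
    by (intro mult_left_mono clip_dist) auto
  finally show ?thesis .
qed

text \<open>The integrand is the \<open>r\<close>-derivative of
  \<open>exp (12 * (x * r)) * D / 2\<close>. The 6 combines the factor 2 of
  \<open>sn_le_double\<close> with the Lipschitz constant 3; the rate 12 of the weight is twice
  that, which yields the contraction factor 1/2.\<close>

lemma weight_integral: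
  fixes x D :: real
  assumes "0 \<le> x" "0 \<le> D"
  shows "exp (- (12 * x)) * integral {0..1} (\<lambda>r. 6 * x * exp (12 * (x * r)) * D) \<le> D / 2"
proof -
  have "((\<lambda>r. 6 * x * exp (12 * (x * r)) * D) has_integral
      (exp (12 * (x * 1)) / 2 * D - exp (12 * (x * 0)) / 2 * D)) {0..1}"
    by (intro fundamental_theorem_of_calculus)
       (auto intro!: derivative_eq_intros simp flip: has_real_derivative_iff_has_vector_derivative)
  then have "integral {0..1} (\<lambda>r. 6 * x * exp (12 * (x * r)) * D) = exp (12 * (x * 1)) / 2 * D - exp (12 * (x * 0)) / 2 * D"
    by (rule integral_unique)
  then have "exp (- (12 * x)) * integral {0..1} (\<lambda>r. 6 * x * exp (12 * (x * r)) * D)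
     = (1 - exp (- (12 * x))) * (D / 2)"
    by (simp add: algebra_simps exp_minus field_simps)
  also have "\<dots> \<le> 1 * (D / 2)"
    using assms by (intro mult_right_mono) auto
  finally show ?thesis by simp
qed

subsection \<open>The unstable manifold\<close>

text \<open>The substitution \<open>y = x r\<close> removes the singularity at \<open>x = 0\<close> from
  \<open>v x = (1/x) \<integral>\<^sub>0\<^sup>x sn y * riccati \<dots> dy\<close>; the function \<open>w = exp (-12 x) v\<close> carries the weight that makes
  the operator a contraction. Clipping makes the Riccati nonlinearity globally Lipschitz and is
  undone in \<open>unst_le_1\<close>.\<close>

definition unstable_op :: "(real \<times> real \<times> real \<Rightarrow> real) \<Rightarrow> real \<times> real \<times> real \<Rightarrow> real" where
  "unstable_op w = (\<lambda>(m, E, x). exp (- (12 * clip x)) *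
     integral {0..1} (\<lambda>r. sn (clip x * r) * riccati a (clip m) (clip E) (clip x * r)
       (clip (exp (12 * (clip x * r)) * w (m, E, clip x * r)))))"

lemma unstable_op_integrand_continuous:
  assumes "continuous_on UNIV w"
  shows "continuous_on (UNIV \<times> cbox 0 1) (\<lambda>((m, E, x), r). sn (clip x * r) * riccati a (clip m) (clip E) (clip x * r)
       (clip (exp (12 * (clip x * r)) * w (m, E, clip x * r))))"
  unfolding split_beta
  by (intro continuous_intros continuous_on_compose2[OF assms]) auto

lemma unstable_op_integrand_continuous':
  assumes "continuous_on UNIV w"
  shows "continuous_on {0..1} (\<lambda>r. sn (clip x * r) * riccati a (clip m) (clip E) (clip x * r)
       (clip (exp (12 * (clip x * r)) * w (m, E, clip x * r))))"
  by (intro continuous_intros continuous_on_compose2[OF assms]) auto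

lemma unstable_op_bcontfun:
  assumes "continuous_on UNIV w"
  shows "unstable_op w \<in> bcontfun"
proof -
  let ?g = "\<lambda>p r. case p of (m, E, x) \<Rightarrow> sn (clip x * r) * riccati a (clip m) (clip E) (clip x * r)
       (clip (exp (12 * (clip x * r)) * w (m, E, clip x * r)))"
  have "continuous_on UNIV (\<lambda>p. integral (cbox 0 1) (?g p))"
    by (rule integral_continuous_on_param)
       (use unstable_op_integrand_continuous[OF assms] in \<open>simp add: split_beta\<close>)
  then have "continuous_on UNIV (unstable_op w)"
    unfolding unstable_op_def split_beta by (intro continuous_intros) (simp add: split_beta)
  moreover have "\<bar>unstable_op w p\<bar> \<le> 4" for p
  proof -
    obtain m E x where p: "p = (m, E, x)" by (cases p)
    have "norm (integral {0..1} (?g p)) \<le> 4 * (1 - 0)"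
    proof (rule integral_bound)
      show "continuous_on {0..1} (?g p)"
        using unstable_op_integrand_continuous'[OF assms] by (simp add: p)
      fix r :: real assume r: "r \<in> {0..1}"
      then have "clip x * r \<in> {0..1}" by (auto intro: mult_le_one)
      then show "norm (?g p r) \<le> 4"
        using riccati_bounds[of "clip m" "clip E" "clip x * r" "clip (exp (12 * (clip x * r)) * w (m, E, clip x * r))"]
          sn_nonneg[of "clip x * r"] sn_le_1[of "clip x * r"]
          mult_mono[of "sn (clip x * r)" 1 "riccati a (clip m) (clip E) (clip x * r) (clip (exp (12 * (clip x * r)) * w (m, E, clip x * r)))" 4]
        by (simp add: p abs_mult)
    qed simp
    then have "\<bar>unstable_op w p\<bar> \<le> exp (- (12 * clip x)) * 4"
      by (simp add: unstable_op_def p abs_mult)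
    also have "\<dots> \<le> 1 * 4" by (intro mult_right_mono) auto
    finally show ?thesis by simp
  qed
  then have "bounded (range (unstable_op w))"
    by (auto simp: bounded_iff intro!: exI[of _ 4])
  ultimately show ?thesis by (simp add: bcontfun_def)
qed

lemma unstable_op_contraction:
  assumes w: "continuous_on UNIV w1" "continuous_on UNIV w2" and D: "\<And>p. \<bar>w1 p - w2 p\<bar> \<le> D"
  shows "\<bar>unstable_op w1 p - unstable_op w2 p\<bar> \<le> D / 2"
proof -
  obtain m E x where p: "p = (m, E, x)" by (cases p)
  define c where "c = clip x"
  let ?g = "\<lambda>w r. sn (c * r) * riccati a (clip m) (clip E) (c * r)
       (clip (exp (12 * (c * r)) * w (m, E, c * r)))"
  have D0: "0 \<le> D" using D[of p] by linarith
  have c: "0 \<le> c" "c \<le> 1" by (auto simp: c_def)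
  have int: "?g w integrable_on {0..1}" if "continuous_on UNIV w" for w
    using unstable_op_integrand_continuous'[OF that] unfolding c_def by (rule integrable_continuous_real)
  have "norm (integral {0..1} (\<lambda>r. ?g w1 r - ?g w2 r)) \<le> integral {0..1} (\<lambda>r. 6 * c * exp (12 * (c * r)) * D)"
  proof (rule integral_norm_bound_integral)
    show "(\<lambda>r. ?g w1 r - ?g w2 r) integrable_on {0..1}"
      by (intro integrable_diff int w)
    show "(\<lambda>r. 6 * c * exp (12 * (c * r)) * D) integrable_on {0..1}"
      by (intro integrable_continuous_real continuous_intros)
    fix r :: real assume r: "r \<in> {0..1}"
    have cr: "c * r \<in> {0..1}" using r c by (auto intro: mult_le_one)
    have "c * r \<le> c * 1" using r c by (intro mult_left_mono) auto
    then have sn: "0 \<le> sn (c * r)" "sn (c * r) \<le> 2 * c"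
      using sn_nonneg[of "c * r"] sn_le_double[of "c * r"] cr by auto
    have lip: "\<bar>riccati a (clip m) (clip E) (c * r) (clip u) - riccati a (clip m) (clip E) (c * r) (clip v)\<bar> \<le> 3 * \<bar>u - v\<bar>" for u v
      using cr by (intro riccati_lipschitz) auto
    have "norm (?g w1 r - ?g w2 r) \<le> (2 * c) * (3 * \<bar>exp (12 * (c * r)) * w1 (m, E, c * r) - exp (12 * (c * r)) * w2 (m, E, c * r)\<bar>)"
      unfolding right_diff_distrib[of "sn (c * r)", symmetric] real_norm_def abs_mult[of "sn (c * r)"]
      using sn c lip by (intro mult_mono) auto
    also have "\<dots> = (2 * c) * (3 * (exp (12 * (c * r)) * \<bar>w1 (m, E, c * r) - w2 (m, E, c * r)\<bar>))"
      by (simp add: right_diff_distrib[symmetric] abs_mult)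
    also have "\<dots> \<le> (2 * c) * (3 * (exp (12 * (c * r)) * D))"
      using D c by (intro mult_left_mono) auto
    finally show "norm (?g w1 r - ?g w2 r) \<le> 6 * c * exp (12 * (c * r)) * D"
      by (simp add: mult.assoc)
  qed
  then have "exp (- (12 * c)) * norm (integral {0..1} (\<lambda>r. ?g w1 r - ?g w2 r)) \<le> exp (- (12 * c)) * integral {0..1} (\<lambda>r. 6 * c * exp (12 * (c * r)) * D)"
    by (intro mult_left_mono) auto
  also have "\<dots> \<le> D / 2"
    by (rule weight_integral[OF c(1) D0])
  also have "integral {0..1} (\<lambda>r. ?g w1 r - ?g w2 r) = integral {0..1} (?g w1) - integral {0..1} (?g w2)"
    by (intro integral_diff int w)
  finally show ?thesis
    by (simp add: p unstable_op_def abs_mult c_def right_diff_distrib[symmetric])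
qed

text \<open>With \<open>m\<close>, \<open>E\<close> and \<open>x\<close> clipped, the operator acts
  on bounded continuous functions of three real variables, a complete space whose elements are
  jointly continuous. Banach's theorem thus gives the solutions for all parameters at once.\<close>

lemma ex_unstable_manifold:
  "\<exists>v. continuous_on ({0..1} \<times> {0..1} \<times> {0..1}) (\<lambda>(m, E, x). v m E x) \<and>
    (\<forall>m\<in>{0..1}. \<forall>E\<in>{0..1}. \<forall>x\<in>{0..1}.
      v m E x = integral {0..1} (\<lambda>r. sn (x * r) * riccati a m E (x * r) (clip (v m E (x * r)))))"
proof -
  have app: "apply_bcontfun (Bcontfun (unstable_op w)) = unstable_op w" if "continuous_on UNIV w" for w
    using unstable_op_bcontfun[OF that] by (rule Bcontfun_inverse)
  have "\<exists>!w :: (real \<times> real \<times> real) \<Rightarrow>\<^sub>C real. Bcontfun (unstable_op (apply_bcontfun w)) = w"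
  proof (rule banach_fix_type)
    show "\<forall>w1 w2 :: (real \<times> real \<times> real) \<Rightarrow>\<^sub>C real. dist (Bcontfun (unstable_op (apply_bcontfun w1))) (Bcontfun (unstable_op (apply_bcontfun w2))) \<le> 1/2 * dist w1 w2"
    proof (intro allI dist_bound)
      fix w1 w2 :: "(real \<times> real \<times> real) \<Rightarrow>\<^sub>C real" and p
      show "dist (apply_bcontfun (Bcontfun (unstable_op w1)) p) (apply_bcontfun (Bcontfun (unstable_op w2)) p) \<le> 1/2 * dist w1 w2"
        using unstable_op_contraction[of w1 w2 "dist w1 w2" p] dist_bounded[of w1 _ w2]
        by (simp add: app dist_real_def)
    qed
  qed auto
  then obtain w :: "(real \<times> real \<times> real) \<Rightarrow>\<^sub>C real" where "Bcontfun (unstable_op (apply_bcontfun w)) = w"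
    by blast
  then have w: "unstable_op (apply_bcontfun w) = apply_bcontfun w"
    using app[of "apply_bcontfun w"] by simp
  \<comment> \<open>Undoes the exponential weight carried by the fixed point
    \<open>w\<close>.\<close>
  define v where "v m E x = exp (12 * x) * w (m, E, x)" for m E x
  have "continuous_on ({0..1} \<times> {0..1} \<times> {0..1}) (\<lambda>(m, E, x). v m E x)"
    unfolding v_def split_beta by (intro continuous_intros continuous_on_compose2[OF continuous_on_apply_bcontfun[of UNIV w]]) auto
  moreover have "v m E x = integral {0..1} (\<lambda>r. sn (x * r) * riccati a m E (x * r) (clip (v m E (x * r))))"
    if "m \<in> {0..1}" "E \<in> {0..1}" "x \<in> {0..1}" for m E x
    using that fun_cong[OF w, of "(m, E, x)"]
    by (simp add: v_def unstable_op_def clip_id exp_minus field_simps)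
  ultimately show ?thesis by blast
qed

end

section \<open>Derivative and bounds of the unstable manifold\<close>

context theta_flow
begin

text \<open>For v = x one has (x v)' = 2 x, so the second summand is the defect of this function in
  the equation. For \<open>0 \<le> x\<close> and \<open>E\<close> in [0, 1] it is nonpositive at
  \<open>m = 1\<close> and nonnegative at \<open>m = E\<close>.\<close>

lemma sn_riccati_diagonal:
  "sn x * riccati a m E x x = 2 * x + 2 * x * a * (1 - m - (1 - E) * (sn x)\<^sup>2)"
proof -
  have 1: "sn x * (1 + x\<^sup>2) = 2 * x" and 2: "1 - x\<^sup>2 = cs x * (1 + x\<^sup>2)"
    by (simp_all add: sn_def cs_def)
  have "sn x * riccati a m E x x
      = 2 * a * E * (sn x)\<^sup>2 * x + a * (cs x)\<^sup>2 * (sn x * (1 + x\<^sup>2)) + (1 - a * m) * (sn x * (1 + x\<^sup>2))"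
    unfolding riccati_def 2 by (simp add: power2_eq_square algebra_simps)
  also have "(cs x)\<^sup>2 = 1 - (sn x)\<^sup>2"
    using sn_cs[of x] by simp
  finally show ?thesis
    unfolding 1 by (simp add: algebra_simps)
qed

text \<open>One selection for all parameters together, so that joint continuity is part of the
  selected property.\<close>

definition unst :: "real \<Rightarrow> real \<Rightarrow> real \<Rightarrow> real" where
  "unst = (SOME v. continuous_on ({0..1} \<times> {0..1} \<times> {0..1}) (\<lambda>(m, E, x). v m E x) \<and>
    (\<forall>m\<in>{0..1}. \<forall>E\<in>{0..1}. \<forall>x\<in>{0..1}.
      v m E x = integral {0..1} (\<lambda>r. sn (x * r) * riccati a m E (x * r) (clip (v m E (x * r))))))"

lemma unst_continuous: "continuous_on ({0..1} \<times> {0..1} \<times> {0..1}) (\<lambda>(m, E, x). unst m E x)"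
  and unst_fixpoint: "m \<in> {0..1} \<Longrightarrow> E \<in> {0..1} \<Longrightarrow> x \<in> {0..1} \<Longrightarrow>
      unst m E x = integral {0..1} (\<lambda>r. sn (x * r) * riccati a m E (x * r) (clip (unst m E (x * r))))"
  using someI_ex[OF ex_unstable_manifold] unfolding unst_def[symmetric] by blast+

lemma continuous_on_unst [continuous_intros]:
  assumes "continuous_on A m" "continuous_on A E" "continuous_on A x"
    and "\<And>p. p \<in> A \<Longrightarrow> m p \<in> {0..1} \<and> E p \<in> {0..1} \<and> x p \<in> {0..1}"
  shows "continuous_on A (\<lambda>p. unst (m p) (E p) (x p))"
proof -
  have "continuous_on A (\<lambda>p. (m p, E p, x p))"
    by (intro continuous_intros assms)
  from continuous_on_compose2[OF unst_continuous this] show ?thesis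
    using assms(4) by (auto simp: image_subset_iff)
qed

context
  fixes m E :: real
  assumes mE: "m \<in> {0..1}" "E \<in> {0..1}"
begin

lemma unst_nonneg: "x \<in> {0..1} \<Longrightarrow> 0 \<le> unst m E x"
  using mE unfolding unst_fixpoint[OF mE]
  by (intro Henstock_Kurzweil_Integration.integral_nonneg integrable_continuous_real continuous_intros mult_nonneg_nonneg
      sn_nonneg riccati_bounds) (auto intro: mult_le_one)

lemma unst_at_0: "unst m E 0 = 0"
  by (subst unst_fixpoint[OF mE]) auto

text \<open>The product with \<open>x\<close> is a plain primitive after rescaling, so it can be
  differentiated up to the singular point 0.\<close>

lemma unst_deriv:
  assumes "x \<in> {0..1}"
  shows "((\<lambda>x. x * unst m E x) has_real_derivative sn x * riccati a m E x (clip (unst m E x))) (at x within {0..1})"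
proof (rule has_field_derivative_transform_within[OF _ zero_less_one assms])
  have cont: "continuous_on {0..1} (\<lambda>x. sn x * riccati a m E x (clip (unst m E x)))"
    by (intro continuous_intros) (use mE in auto)
  show "((\<lambda>x. integral {0..x} (\<lambda>x. sn x * riccati a m E x (clip (unst m E x))))
      has_real_derivative sn x * riccati a m E x (clip (unst m E x))) (at x within {0..1})"
    by (rule integral_has_real_derivative[OF cont assms])
  show "integral {0..y} (\<lambda>x. sn x * riccati a m E x (clip (unst m E x))) = y * unst m E y"
    if "y \<in> {0..1}" for y
    using integral_rescale_unit[OF cont that] unst_fixpoint[OF mE that] by simp
qed

lemma unst_deriv_at:
  assumes "0 < x" "x < 1"
  shows "((\<lambda>x. x * unst m E x) has_real_derivative sn x * riccati a m E x (clip (unst m E x))) (at x)"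
  using unst_deriv[of x] assms at_within_interior[of x "{0..1}"] by simp

text \<open>On \<open>v = 1\<close> the field points downwards up to some \<open>x\<close> and upwards after it, so an excursion
  above \<open>1\<close> could not have started before that \<open>x\<close> and could not end after it.\<close>

lemma unst_le_1:
  assumes u1: "unst m E 1 = 1" and x: "x \<in> {0..1}"
  shows "unst m E x \<le> 1"
proof (rule ccontr)
  assume "\<not> unst m E x \<le> 1"
  then have big: "1 < unst m E x" by simp
  then have "x \<noteq> 0" "x \<noteq> 1" using u1 unst_at_0 by auto
  then have x: "0 < x" "x < 1" using x by auto
  define f where "f y = y - y * unst m E y" for y
  \<comment> \<open>Where \<open>unst m E y\<close> exceeds 1 its clipped value is 1 and the term
    with 1 - v^2 drops out, so the derivative of \<open>f\<close> depends on \<open>y\<close> only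
    through \<open>s = sn y\<close>.\<close>
  define k where "k s = 1 - s * (2 * a * E * s + 2 * (1 - a * m))" for s
  have cont: "continuous_on {0..1} f"
    unfolding f_def by (intro continuous_intros) (use mE in auto)
  have k_mono: "k t \<le> k s" if "0 \<le> s" "s \<le> t" for s t
    unfolding k_def using that a a_mult_unit[of m] mE
    by (auto intro!: mult_mono add_mono mult_left_mono add_nonneg_nonneg)
  have der: "(f has_real_derivative k (sn y)) (at y)" if "0 < y" "y < 1" "f y < 0" for y
  proof -
    have "clip (unst m E y) = 1"
      using that by (auto simp: f_def clip_def)
    then have "k (sn y) = 1 - sn y * riccati a m E y (clip (unst m E y))"
      by (simp add: k_def riccati_def algebra_simps)
    then show ?thesis
      unfolding f_def using DERIV_diff[OF DERIV_ident unst_deriv_at] that by simp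
  qed
  have fx: "f x < 0" using big x by (simp add: f_def)
  show False
  proof (cases "0 \<le> k (sn x)")
    case True
    have "0 \<le> f x"
    proof (rule nonneg_of_deriv_nonneg_below[of 0 x f])
      show "continuous_on {0..x} f" using cont x by (auto intro: continuous_on_subset)
      fix y assume y: "0 < y" "y < x" "f y < 0"
      have "0 \<le> k (sn y)"
        using True k_mono[of "sn y" "sn x"] sn_mono[of y x] sn_nonneg[of y] x y by simp
      then show "\<exists>d. (f has_real_derivative d) (at y) \<and> 0 \<le> d"
        using der[of y] x y by auto
    qed (use x in \<open>auto simp: f_def\<close>)
    with fx show False by simp
  next
    case False
    \<comment> \<open>The sign lemma runs forward; here it is applied to the reflected function,
      starting from \<open>f 1 = 0\<close>.\<close>
    have "0 \<le> f (1 - (1 - x))"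
    proof (rule nonneg_of_deriv_nonneg_below[of 0 "1 - x" "\<lambda>y. f (1 - y)"])
      show "continuous_on {0..1 - x} (\<lambda>y. f (1 - y))"
        using x by (intro continuous_on_compose2[OF cont] continuous_intros) auto
      fix y assume y: "0 < y" "y < 1 - x" "f (1 - y) < 0"
      have "k (sn (1 - y)) \<le> 0"
        using False k_mono[of "sn x" "sn (1 - y)"] sn_mono[of x "1 - y"] sn_nonneg[of x] x y by simp
      moreover have "((\<lambda>y. f (1 - y)) has_real_derivative - k (sn (1 - y))) (at y)"
        using DERIV_chain2[OF der[of "1 - y"] DERIV_diff[OF DERIV_const DERIV_ident]] x y by simp
      ultimately show "\<exists>d. ((\<lambda>y. f (1 - y)) has_real_derivative d) (at y) \<and> 0 \<le> d"
        by auto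
    qed (use x u1 in \<open>auto simp: f_def\<close>)
    with fx show False by simp
  qed
qed

end

section \<open>Barriers at the end point and choice of the parameter\<close>

text \<open>By \<open>sn_riccati_diagonal\<close>, v = x is a supersolution. The Gronwall factor
  \<open>exp (- (6 * x))\<close> absorbs the Lipschitz error, which is at most 6 (x v - x^2) because
  \<open>sn x\<close> \<le> 2 x and the Lipschitz constant is 3.\<close>

lemma unst_end_le_1:
  assumes E: "E \<in> {0..1}" shows "unst 1 E 1 \<le> 1"
proof -
  have m: "(1::real) \<in> {0..1}" by simp
  let ?f = "\<lambda>x. (x * x - x * unst 1 E x) * exp (- (6 * x))"
  have "0 \<le> ?f 1"
  proof (rule nonneg_of_deriv_nonneg_below[of 0 1 ?f])
    show "continuous_on {0..1} ?f"
      by (intro continuous_intros) (use E in auto)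
    fix x assume x: "0 < x" "x < 1" "?f x < 0"
    then have "x * x < x * unst 1 E x"
      by (simp add: mult_less_0_iff)
    then have less: "x < unst 1 E x" using x by simp
    let ?d = "2 * x - sn x * riccati a 1 E x (clip (unst 1 E x)) - 6 * (x * x - x * unst 1 E x)"
    have "riccati a 1 E x (clip (unst 1 E x)) \<le> riccati a 1 E x (clip x) + 3 * (unst 1 E x - x)"
      using riccati_lipschitz[OF m E, of x "unst 1 E x" x] x less by auto
    then have "sn x * riccati a 1 E x (clip (unst 1 E x)) \<le> sn x * (riccati a 1 E x (clip x) + 3 * (unst 1 E x - x))"
      using sn_nonneg[of x] x by (intro mult_left_mono) auto
    also have "\<dots> = 2 * x - 2 * x * a * ((1 - E) * (sn x)\<^sup>2) + sn x * (3 * (unst 1 E x - x))"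
      using sn_riccati_diagonal[of x 1 E] x by (simp add: clip_id algebra_simps)
    also have "\<dots> \<le> 2 * x + (2 * x) * (3 * (unst 1 E x - x))"
    proof -
      have "0 \<le> 2 * x * a * ((1 - E) * (sn x)\<^sup>2)"
        using x a E by simp
      moreover have "sn x * (3 * (unst 1 E x - x)) \<le> (2 * x) * (3 * (unst 1 E x - x))"
        using less x sn_le_double[of x] by (intro mult_right_mono) auto
      ultimately show ?thesis by linarith
    qed
    finally have "0 \<le> ?d" by (simp add: algebra_simps)
    moreover have "(?f has_real_derivative ?d * exp (- (6 * x))) (at x)"
      by (rule derivative_eq_intros unst_deriv_at[OF m E] refl x)+ (simp add: algebra_simps)
    ultimately show "\<exists>y. (?f has_real_derivative y) (at x) \<and> 0 \<le> y"
      by (intro exI[of _ "?d * exp (- (6 * x))"]) simp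
  qed auto
  then show ?thesis by (simp add: zero_le_mult_iff)
qed

text \<open>Mirror image of the preceding comparison: for \<open>m = E\<close> the defect of v = x
  has the nonnegative factor \<open>(1 - E) * (1 - (sn x)^2)\<close>, so v = x is a
  subsolution.\<close>

lemma unst_end_ge_1:
  assumes E: "E \<in> {0..1}" shows "1 \<le> unst E E 1"
proof -
  let ?f = "\<lambda>x. (x * unst E E x - x * x) * exp (- (6 * x))"
  have "0 \<le> ?f 1"
  proof (rule nonneg_of_deriv_nonneg_below[of 0 1 ?f])
    show "continuous_on {0..1} ?f"
      by (intro continuous_intros) (use E in auto)
    fix x assume x: "0 < x" "x < 1" "?f x < 0"
    then have "x * unst E E x < x * x"
      by (simp add: mult_less_0_iff)
    then have less: "unst E E x < x" using x by simp
    let ?d = "sn x * riccati a E E x (clip (unst E E x)) - 2 * x - 6 * (x * unst E E x - x * x)"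
    have "2 * x - (2 * x) * (3 * (x - unst E E x)) \<le> 
        2 * x + 2 * x * a * ((1 - E) * (1 - (sn x)\<^sup>2)) - sn x * (3 * (x - unst E E x))"
    proof -
      have "(sn x)\<^sup>2 \<le> 1"
        using sn_nonneg[of x] sn_le_1[of x] x by (simp add: power_le_one)
      then have "0 \<le> 2 * x * a * ((1 - E) * (1 - (sn x)\<^sup>2))"
        using x a E by simp
      moreover have "sn x * (3 * (x - unst E E x)) \<le> (2 * x) * (3 * (x - unst E E x))"
        using less x sn_le_double[of x] by (intro mult_right_mono) auto
      ultimately show ?thesis by linarith
    qed
    also have "\<dots> = sn x * (riccati a E E x (clip x) - 3 * (x - unst E E x))"
      using sn_riccati_diagonal[of x E E] x by (simp add: clip_id algebra_simps)
    also have "\<dots> \<le> sn x * riccati a E E x (clip (unst E E x))"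
    proof (rule mult_left_mono)
      show "riccati a E E x (clip x) - 3 * (x - unst E E x) \<le> riccati a E E x (clip (unst E E x))"
        using riccati_lipschitz[OF E E, of x "unst E E x" x] x less by auto
      show "0 \<le> sn x" using sn_nonneg[of x] x by simp
    qed
    finally have "0 \<le> ?d" by (simp add: algebra_simps)
    moreover have "(?f has_real_derivative ?d * exp (- (6 * x))) (at x)"
      by (rule derivative_eq_intros unst_deriv_at[OF E E] refl x)+ (simp add: algebra_simps)
    ultimately show "\<exists>y. (?f has_real_derivative y) (at x) \<and> 0 \<le> y"
      by (intro exI[of _ "?d * exp (- (6 * x))"]) simp
  qed auto
  then show ?thesis by (simp add: zero_le_mult_iff)
qed

lemma ex_connecting_parameter:
  assumes E: "E \<in> {0..1}" shows "\<exists>m. m \<in> {E..1} \<and> unst m E 1 = 1"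
proof -
  have "continuous_on {E..1} (\<lambda>m. unst m E 1)"
    by (intro continuous_intros) (use E in auto)
  then show ?thesis
    using IVT2'[of "\<lambda>m. unst m E 1" 1 1 E] unst_end_le_1[OF E] unst_end_ge_1[OF E] E by auto
qed

text \<open>Any selection serves: the exact difference formula \<open>mu_diff\<close> is proved for
  it and supplies its regularity.\<close>

definition mu :: "real \<Rightarrow> real" where
  "mu E = (SOME m. m \<in> {E..1} \<and> unst m E 1 = 1)"

definition conn :: "real \<Rightarrow> real \<Rightarrow> real" where
  "conn E = unst (mu E) E"

context
  fixes E :: real assumes E: "E \<in> {0..1}"
begin

lemma mu_in: "mu E \<in> {E..1}" and conn_at_1: "conn E 1 = 1"
  using someI_ex[OF ex_connecting_parameter[OF E]] by (simp_all add: mu_def conn_def)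

lemma mu_unit: "mu E \<in> {0..1}"
  using mu_in E by auto

lemma conn_at_0: "conn E 0 = 0"
  unfolding conn_def by (rule unst_at_0[OF mu_unit E])

lemma conn_unit: "x \<in> {0..1} \<Longrightarrow> conn E x \<in> {0..1}"
  using unst_nonneg[OF mu_unit E] unst_le_1[OF mu_unit E] conn_at_1 by (simp add: conn_def)

lemma conn_deriv:
  assumes "x \<in> {0..1}"
  shows "((\<lambda>x. x * conn E x) has_real_derivative sn x * riccati a (mu E) E x (conn E x)) (at x within {0..1})"
  using unst_deriv[OF mu_unit E assms] conn_unit[OF assms] by (simp add: conn_def clip_id)

end

end

subsection \<open>Connectors as solutions of a scalar equation\<close>

definition theta_rhs :: "real \<Rightarrow> real \<Rightarrow> real \<Rightarrow> real \<Rightarrow> real \<Rightarrow> real" where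
  "theta_rhs a E lam t y = - 2 * a * sn (exp t) * cs (exp t) * cos y
     + 2 * a * E * (sn (exp t))\<^sup>2 * sin y - sin y + 2 * lam * sn (exp t)"

lemma sin_2_arctan: "sin (2 * arctan x) = sn x"
proof -
  have "sin (2 * arctan x) = 2 * sin (arctan x) * cos (arctan x)" by (rule sin_double)
  also have "\<dots> = 2 * x / (sqrt (1 + x\<^sup>2))\<^sup>2"
    by (simp add: sin_arctan cos_arctan power2_eq_square)
  finally show ?thesis by (simp add: sn_def)
qed

lemma cos_2_arctan: "cos (2 * arctan x) = cs x"
proof -
  have "cos (2 * arctan x) = (cos (arctan x))\<^sup>2 - (sin (arctan x))\<^sup>2" by (rule cos_double)
  also have "\<dots> = (1 - x\<^sup>2) / (sqrt (1 + x\<^sup>2))\<^sup>2"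
    by (simp add: sin_arctan cos_arctan power_divide diff_divide_distrib)
  finally show ?thesis by (simp add: cs_def)
qed

lemma sn_exp_uminus: "sn (exp (- t)) = sn (exp t)"
proof -
  have "1 + (exp (- t))\<^sup>2 = (1 + (exp t)\<^sup>2) / (exp t)\<^sup>2"
    by (simp add: exp_minus field_simps)
  then show ?thesis by (simp add: sn_def exp_minus field_simps power2_eq_square)
qed

lemma cs_exp_uminus: "cs (exp (- t)) = - cs (exp t)"
proof -
  have "1 + (exp (- t))\<^sup>2 = (1 + (exp t)\<^sup>2) / (exp t)\<^sup>2"
    and "1 - (exp (- t))\<^sup>2 = - (1 - (exp t)\<^sup>2) / (exp t)\<^sup>2"
    by (simp_all add: exp_minus field_simps)
  then show ?thesis by (simp add: cs_def minus_divide_left)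
qed

text \<open>Solutions of \<open>\<theta>' = sin \<theta>\<close> in \<open>(0, \<pi>)\<close> are time shifts of \<open>2 arctan (exp t)\<close>, so a
  connector is the same as a heteroclinic solution of one scalar nonautonomous equation.\<close>

definition scalar_connector :: "real \<Rightarrow> real \<Rightarrow> real \<Rightarrow> (real \<Rightarrow> real) \<Rightarrow> bool" where
  "scalar_connector a E lam y \<longleftrightarrow>
     (\<forall>t. (y has_real_derivative theta_rhs a E lam t (y t)) (at t)) \<and>
     (y \<longlongrightarrow> 0) at_bot \<and> (y \<longlongrightarrow> - pi) at_top"

lemma theta_field_2_arctan:
  "theta_field a E lam (2 * arctan (exp t), y) = (sn (exp t), theta_rhs a E lam t y)"
  by (simp add: theta_field_def theta_rhs_def sin_2_arctan cos_2_arctan)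

lemma saddles_connector_iff: "saddles_connector a E lam \<longleftrightarrow> (\<exists>y. scalar_connector a E lam y)"
proof
  assume "\<exists>y. scalar_connector a E lam y"
  then obtain y where y: "\<And>t. (y has_real_derivative theta_rhs a E lam t (y t)) (at t)"
    "(y \<longlongrightarrow> 0) at_bot" "(y \<longlongrightarrow> - pi) at_top"
    by (auto simp: scalar_connector_def)
  let ?x = "\<lambda>t. (2 * arctan (exp t), y t)"
  have "((\<lambda>t. 2 * arctan (exp t)) has_real_derivative sn (exp t)) (at t)" for t
    by (auto intro!: derivative_eq_intros simp: sn_def field_simps)
  then have "theta_flow_solution a E lam ?x"
    unfolding theta_flow_solution_def theta_field_2_arctan
    using y(1) by (auto intro!: has_vector_derivative_Pair simp flip: has_real_derivative_iff_has_vector_derivative)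
  moreover have "(?x \<longlongrightarrow> (2 * arctan 0, 0)) at_bot"
    by (intro tendsto_intros y exp_at_bot)
  moreover have "filterlim (\<lambda>t. arctan (exp t)) (nhds (pi / 2)) at_top"
    by (rule filterlim_compose[OF tendsto_arctan_at_top exp_at_top])
  then have "(?x \<longlongrightarrow> (2 * (pi / 2), - pi)) at_top"
    by (intro tendsto_intros y)
  moreover have "fst (?x t) \<in> {0<..<pi}" for t
    using arctan_ubound[of "exp t"] by simp
  ultimately show "saddles_connector a E lam"
    unfolding saddles_connector_def by (intro exI[of _ ?x]) simp
next
  assume "saddles_connector a E lam"
  then obtain x where x: "\<And>t. (x has_vector_derivative theta_field a E lam (x t)) (at t)"
      "\<And>t. fst (x t) \<in> {0<..<pi}" "(x \<longlongrightarrow> (0, 0)) at_bot" "(x \<longlongrightarrow> (pi, - pi)) at_top"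
    unfolding saddles_connector_def theta_flow_solution_def by blast
  have th: "((\<lambda>t. fst (x t)) has_real_derivative sin (fst (x t))) (at t)" for t
  proof -
    have "((\<lambda>t. fst (x t)) has_vector_derivative fst (theta_field a E lam (x t))) (at t)"
      by (rule bounded_linear.has_vector_derivative[OF bounded_linear_fst x(1)])
    then show ?thesis
      by (simp add: theta_field_def split_beta has_real_derivative_iff_has_vector_derivative)
  qed
  have Th: "((\<lambda>t. snd (x t)) has_real_derivative snd (theta_field a E lam (x t))) (at t)" for t
    using bounded_linear.has_vector_derivative[OF bounded_linear_snd x(1)]
    by (simp add: has_real_derivative_iff_has_vector_derivative)
  \<comment> \<open>The equation for \<theta> makes u = tan (\<theta>/2) satisfy u' = u, so
    \<open>h\<close> is a first integral.\<close>
  define h where "h t = tan (fst (x t) / 2) * exp (- t)" for t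
  have h': "(h has_real_derivative 0) (at t)" for t
  proof -
    have pos: "0 < cos (fst (x t) / 2)"
      using x(2)[of t] by (intro cos_gt_zero) auto
    have "((\<lambda>t. tan (fst (x t) / 2)) has_real_derivative
        inverse ((cos (fst (x t) / 2))\<^sup>2) * (sin (fst (x t)) / 2)) (at t)"
      using pos by (intro DERIV_chain2[OF DERIV_tan]) (auto intro!: derivative_eq_intros th)
    also have "inverse ((cos (fst (x t) / 2))\<^sup>2) * (sin (fst (x t)) / 2) = tan (fst (x t) / 2)"
      using pos sin_double[of "fst (x t) / 2"] by (simp add: tan_def field_simps power2_eq_square)
    finally have "((\<lambda>t. tan (fst (x t) / 2)) has_real_derivative tan (fst (x t) / 2)) (at t)" .
    moreover have "((\<lambda>t. exp (- t)) has_real_derivative - exp (- t)) (at t)"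
      by (auto intro!: derivative_eq_intros)
    ultimately show ?thesis
      unfolding h_def by (rule DERIV_cong[OF DERIV_mult]) simp
  qed
  \<comment> \<open>As \<open>h\<close> has the constant value \<open>exp c\<close>, delaying time
    by \<open>c\<close> normalises the first component to \<open>2 * arctan (exp t)\<close>.\<close>
  define c where "c = ln (h 0)"
  have "0 < h 0"
    using x(2)[of 0] by (auto simp: h_def intro!: tan_gt_zero)
  have fst_x: "fst (x (t - c)) = 2 * arctan (exp t)" for t
  proof -
    have "h (t - c) = h 0"
      using DERIV_isconst_all[of h] h' by blast
    then have "tan (fst (x (t - c)) / 2) * exp (- (t - c)) = exp c"
      using \<open>0 < h 0\<close> by (simp add: h_def c_def)
    then have "tan (fst (x (t - c)) / 2) = exp t"
      by (simp add: exp_diff exp_minus field_simps)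
    moreover have "arctan (tan (fst (x (t - c)) / 2)) = fst (x (t - c)) / 2"
      using x(2)[of "t - c"] by (intro arctan_tan) auto
    ultimately show ?thesis by simp
  qed
  have "scalar_connector a E lam (\<lambda>t. snd (x (t - c)))"
    unfolding scalar_connector_def
  proof (intro conjI allI)
    fix t
    have "x (t - c) = (2 * arctan (exp t), snd (x (t - c)))"
      using fst_x[of t] by (metis prod.collapse)
    then have "snd (theta_field a E lam (x (t - c))) = theta_rhs a E lam t (snd (x (t - c)))"
      by (metis snd_conv theta_field_2_arctan)
    with DERIV_chain2[OF Th[of "t - c"] DERIV_diff[OF DERIV_ident DERIV_const]]
    show "((\<lambda>t. snd (x (t - c))) has_real_derivative theta_rhs a E lam t (snd (x (t - c)))) (at t)"
      by simp
    have "\<forall>\<^sub>F t in at_bot. t - c \<le> Z" for Z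
      using eventually_le_at_bot[of "Z + c"] by eventually_elim simp
    then have "filterlim (\<lambda>t. t - c) at_bot at_bot"
      by (simp add: filterlim_at_bot)
    then have "((\<lambda>t. x (t - c)) \<longlongrightarrow> (0, 0)) at_bot"
      by (rule filterlim_compose[OF x(3)])
    then show "((\<lambda>t. snd (x (t - c))) \<longlongrightarrow> 0) at_bot"
      using tendsto_snd by fastforce
    have "\<forall>\<^sub>F t in at_top. Z \<le> t - c" for Z
      using eventually_ge_at_top[of "Z + c"] by eventually_elim simp
    then have "filterlim (\<lambda>t. t - c) at_top at_top"
      by (simp add: filterlim_at_top)
    then have "((\<lambda>t. x (t - c)) \<longlongrightarrow> (pi, - pi)) at_top"
      by (rule filterlim_compose[OF x(4)])
    then show "((\<lambda>t. snd (x (t - c))) \<longlongrightarrow> - pi) at_top"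
      using tendsto_snd by fastforce
  qed
  then show "\<exists>y. scalar_connector a E lam y" by blast
qed

section \<open>Time reversal, comparison and uniqueness of connectors\<close>

text \<open>The reflection keeps the sine and negates the cosine of \<open>y\<close>, while
  \<open>sn (exp t)\<close> is even and \<open>cs (exp t)\<close> is odd in \<open>t\<close>; the
  product of the two sign changes is 1.\<close>

lemma theta_rhs_reverse: "theta_rhs a E lam (- t) (- pi - y) = theta_rhs a E lam t y"
  by (simp add: theta_rhs_def sn_exp_uminus cs_exp_uminus sin_diff cos_diff)

text \<open>Stated within a set because the reversal of a half orbit, known only through one-sided
  derivatives at 0, is glued to that half later.\<close>

lemma reverse_deriv:
  assumes "(y has_real_derivative theta_rhs a E lam (- t) (y (- t))) (at (- t) within uminus ` A)"
  shows "((\<lambda>s. - pi - y (- s)) has_real_derivative theta_rhs a E lam t (- pi - y (- t))) (at t within A)"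
proof -
  have "((\<lambda>s. y (- s)) has_real_derivative theta_rhs a E lam (- t) (y (- t)) * (- 1)) (at t within A)"
    using DERIV_image_chain[OF assms DERIV_minus[OF DERIV_ident]] by (simp add: o_def)
  then have "((\<lambda>s. - pi - y (- s)) has_real_derivative theta_rhs a E lam (- t) (y (- t))) (at t within A)"
    by (auto intro!: derivative_eq_intros)
  also have "theta_rhs a E lam (- t) (y (- t)) = theta_rhs a E lam t (- pi - y (- t))"
    using theta_rhs_reverse[of a E lam t "- pi - y (- t)"] by simp
  finally show ?thesis .
qed

lemma scalar_connector_reverse:
  assumes "scalar_connector a E lam y"
  shows "scalar_connector a E lam (\<lambda>t. - pi - y (- t))"
  unfolding scalar_connector_def
proof (intro conjI allI)
  show "((\<lambda>s. - pi - y (- s)) has_real_derivative theta_rhs a E lam t (- pi - y (- t))) (at t)" for t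
    using assms by (intro reverse_deriv) (auto simp: scalar_connector_def intro: has_field_derivative_at_within)
  have "((\<lambda>t. y (- t)) \<longlongrightarrow> - pi) at_bot" "((\<lambda>t. y (- t)) \<longlongrightarrow> 0) at_top"
    using assms filterlim_at_top_mirror filterlim_at_bot_mirror
    unfolding scalar_connector_def by blast+
  from tendsto_diff[OF tendsto_const[of "- pi"] this(1)] tendsto_diff[OF tendsto_const[of "- pi"] this(2)]
  show "((\<lambda>t. - pi - y (- t)) \<longlongrightarrow> 0) at_bot" "((\<lambda>t. - pi - y (- t)) \<longlongrightarrow> - pi) at_top"
    by simp_all
qed

text \<open>Every zero of \<open>f\<close> is an upward crossing. At the first return to nonpositive
  values \<open>f\<close> would already be negative just before, which is impossible.\<close>

lemma pos_after_nonneg: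
  fixes f :: "real \<Rightarrow> real"
  assumes der: "\<And>t. (f has_real_derivative f' t) (at t)" and up: "\<And>t. f t = 0 \<Longrightarrow> 0 < f' t"
    and "p < q" "0 \<le> f p"
  shows "0 < f q"
proof (rule ccontr)
  assume neg: "\<not> 0 < f q"
  have cont: "continuous_on A f" for A
    using der by (meson DERIV_isCont continuous_at_imp_continuous_on)
  have right: "\<exists>d>0. \<forall>h>0. h < d \<longrightarrow> 0 < f (z + h)" if "0 \<le> f z" for z
  proof (cases "f z = 0")
    case True
    then show ?thesis using DERIV_pos_inc_right[OF der up, of z] by simp
  next
    case False
    then have "\<forall>\<^sub>F s in at z. 0 < f s"
      using that order_tendstoD(1)[OF DERIV_isCont[OF der[of z], unfolded isCont_def], of 0] by simp
    then obtain d where "d > 0" "\<And>s. s \<noteq> z \<Longrightarrow> dist s z < d \<Longrightarrow> 0 < f s"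
      by (auto simp: eventually_at)
    then show ?thesis
      by (intro exI[of _ d]) (auto simp: dist_real_def)
  qed
  have left: "\<exists>d>0. \<forall>h>0. h < d \<longrightarrow> f (z - h) < 0" if "f z \<le> 0" for z
  proof (cases "f z = 0")
    case True
    then show ?thesis using DERIV_pos_inc_left[OF der up, of z] by simp
  next
    case False
    then have "\<forall>\<^sub>F s in at z. f s < 0"
      using that order_tendstoD(2)[OF DERIV_isCont[OF der[of z], unfolded isCont_def], of 0] by simp
    then obtain d where "d > 0" "\<And>s. s \<noteq> z \<Longrightarrow> dist s z < d \<Longrightarrow> f s < 0"
      by (auto simp: eventually_at)
    then show ?thesis
      by (intro exI[of _ d]) (auto simp: dist_real_def)
  qed
  obtain d where d: "d > 0" "\<And>h. 0 < h \<Longrightarrow> h < d \<Longrightarrow> 0 < f (p + h)"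
    using right[OF \<open>0 \<le> f p\<close>] by blast
  \<comment> \<open>Since \<open>f p\<close> may vanish, the search for a return starts at a later
    point where \<open>f\<close> is strictly positive; this leaves room to the left of
    \<open>Inf A\<close>.\<close>
  define p' where "p' = p + min (d / 2) (q - p)"
  have p': "p < p'" "p' \<le> q" "0 < f p'"
    using d(1) d(2)[of "min (d / 2) (q - p)"] \<open>p < q\<close> by (auto simp: p'_def)
  define A where "A = {s \<in> {p'..q}. f s \<le> 0}"
  have "closed A" unfolding A_def
    by (rule continuous_on_closed_Collect_le[OF cont continuous_on_const closed_atLeastAtMost])
  moreover have "q \<in> A" using p' neg by (auto simp: A_def)
  moreover have bdd: "bdd_below A" by (auto simp: A_def)
  ultimately have zA: "Inf A \<in> A" by (intro closed_contains_Inf) auto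
  then have z: "p' < Inf A" "f (Inf A) \<le> 0" "Inf A \<le> q"
    using p' by (auto simp: A_def less_le)
  obtain e where e: "e > 0" "\<And>h. 0 < h \<Longrightarrow> h < e \<Longrightarrow> f (Inf A - h) < 0"
    using left[OF z(2)] by blast
  define h where "h = min (e / 2) (Inf A - p')"
  have h: "0 < h" "h < e" "h \<le> Inf A - p'" using e z by (auto simp: h_def)
  then have "Inf A - h \<in> A" using e z by (auto simp: A_def less_imp_le)
  then have "Inf A \<le> Inf A - h" using bdd by (rule cInf_lower)
  with h show False by simp
qed

text \<open>The sine of the half difference is factored out; its cofactor tends to 1 as
  \<open>t\<close> tends to minus infinity if both solutions tend to 0.\<close>

lemma theta_rhs_diff:
  "theta_rhs a E l2 t y2 - theta_rhs a E l1 t y1 =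
     2 * sin ((y1 - y2) / 2) * ((1 - 2 * a * E * (sn (exp t))\<^sup>2) * cos ((y1 + y2) / 2)
       - 2 * a * sn (exp t) * cs (exp t) * sin ((y1 + y2) / 2)) + 2 * sn (exp t) * (l2 - l1)"
proof -
  have 1: "sin y1 - sin y2 = 2 * sin ((y1 - y2) / 2) * cos ((y1 + y2) / 2)"
    by (rule sin_diff_sin)
  have 2: "cos y2 - cos y1 = 2 * sin ((y1 - y2) / 2) * sin ((y1 + y2) / 2)"
    using cos_diff_cos[of y2 y1] by (simp add: add.commute)
  have "theta_rhs a E l2 t y2 - theta_rhs a E l1 t y1 =
      (1 - 2 * a * E * (sn (exp t))\<^sup>2) * (sin y1 - sin y2)
      - 2 * a * sn (exp t) * cs (exp t) * (cos y2 - cos y1) + 2 * sn (exp t) * (l2 - l1)"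
    by (simp add: theta_rhs_def algebra_simps)
  then show ?thesis unfolding 1 2 by (simp add: algebra_simps)
qed

text \<open>As \<open>l1 < l2\<close>, zeros of \<open>y2 - y1\<close> are upward crossings. If the
  difference were nonpositive at a very early time, it would be so at all earlier times and have
  positive derivative there; growing from the limit 0 it would be positive, a contradiction.\<close>

lemma scalar_connector_less:
  assumes y1: "scalar_connector a E l1 y1" and y2: "scalar_connector a E l2 y2" and "l1 < l2"
  shows "y1 t < y2 t"
proof -
  define f where "f t = y2 t - y1 t" for t
  define f' where "f' t = theta_rhs a E l2 t (y2 t) - theta_rhs a E l1 t (y1 t)" for t
  have der: "(f has_real_derivative f' t) (at t)" for t
    using y1 y2 unfolding f_def f'_def scalar_connector_def by (intro DERIV_diff) auto
  have lim: "(y1 \<longlongrightarrow> 0) at_bot" "(y2 \<longlongrightarrow> 0) at_bot"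
    using y1 y2 by (auto simp: scalar_connector_def)
  have up: "0 < f' t" if "f t = 0" for t
    using that \<open>l1 < l2\<close> sn_pos[of "exp t"] by (simp add: f_def f'_def theta_rhs_diff)
  have snl: "((\<lambda>t. sn (exp t)) \<longlongrightarrow> 2 * 0 / (1 + 0\<^sup>2)) at_bot"
    and csl: "((\<lambda>t. cs (exp t)) \<longlongrightarrow> (1 - 0\<^sup>2) / (1 + 0\<^sup>2)) at_bot"
    unfolding sn_def cs_def by (intro tendsto_intros exp_at_bot; simp)+
  define g where "g t = (1 - 2 * a * E * (sn (exp t))\<^sup>2) * cos ((y1 t + y2 t) / 2)
       - 2 * a * sn (exp t) * cs (exp t) * sin ((y1 t + y2 t) / 2)" for t
  have "(g \<longlongrightarrow> (1 - 2 * a * E * (2 * 0 / (1 + 0\<^sup>2))\<^sup>2) * cos ((0 + 0) / 2)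
       - 2 * a * (2 * 0 / (1 + 0\<^sup>2)) * ((1 - 0\<^sup>2) / (1 + 0\<^sup>2)) * sin ((0 + 0) / 2)) at_bot"
    unfolding g_def by (intro tendsto_intros snl csl lim) auto
  then have "(g \<longlongrightarrow> 1) at_bot" by simp
  then have "\<forall>\<^sub>F t in at_bot. 0 < g t"
    by (rule order_tendstoD) simp
  moreover have fl: "(f \<longlongrightarrow> 0) at_bot"
    using tendsto_diff[OF lim(2,1)] by (simp add: f_def[abs_def])
  \<comment> \<open>This bound puts \<open>(y1 t - y2 t) / 2\<close> below \<pi>/2, so that its sine
    is nonnegative whenever \<open>f t \<le> 0\<close>.\<close>
  then have "\<forall>\<^sub>F t in at_bot. - pi < f t"
    by (rule order_tendstoD) simp
  ultimately have "\<forall>\<^sub>F t in at_bot. 0 < g t \<and> - pi < f t"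
    by (rule eventually_conj)
  then obtain b where b: "\<And>t. t \<le> b \<Longrightarrow> 0 < g t" "\<And>t. t \<le> b \<Longrightarrow> - pi < f t"
    by (auto simp: eventually_at_bot_linorder)
  have pos: "0 < f s" if "s \<le> b" for s
  proof (rule ccontr)
    assume neg: "\<not> 0 < f s"
    have "0 < f s"
    proof (rule DERIV_pos_imp_increasing_at_bot[of s f 0, OF _ fl])
      fix r assume "r \<le> s"
      have "f r \<le> 0"
        using pos_after_nonneg[of f f' r s, OF der up] neg \<open>r \<le> s\<close> by (cases "r = s") force+
      then have "0 \<le> sin ((y1 r - y2 r) / 2)"
        using b(2)[of r] \<open>r \<le> s\<close> \<open>s \<le> b\<close> by (intro sin_ge_zero) (auto simp: f_def)
      then have "0 \<le> 2 * sin ((y1 r - y2 r) / 2) * g r"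
        using b(1)[of r] \<open>r \<le> s\<close> \<open>s \<le> b\<close> by (auto intro!: mult_nonneg_nonneg less_imp_le)
      moreover have "0 < 2 * sn (exp r) * (l2 - l1)"
        using \<open>l1 < l2\<close> sn_pos[of "exp r"] by simp
      ultimately have "0 < f' r"
        unfolding f'_def theta_rhs_diff g_def[symmetric] by linarith
      then show "\<exists>d. (f has_real_derivative d) (at r) \<and> 0 < d"
        using der by blast
    qed
    with neg show False by simp
  qed
  have "0 < f t"
    using pos_after_nonneg[of f f' "min b t - 1" t, OF der up] pos[of "min b t - 1"] by force
  then show ?thesis by (simp add: f_def)
qed

text \<open>Time reversal keeps \<lambda> but reverses the order of two connectors, so different
  values of \<lambda> would order them strictly both ways at time 0.\<close>

lemma scalar_connector_unique:
  assumes "scalar_connector a E l1 y1" "scalar_connector a E l2 y2"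
  shows "l1 = l2"
proof -
  have "\<not> l1 < l2" if "scalar_connector a E l1 y1" "scalar_connector a E l2 y2" for l1 l2 y1 y2
  proof
    assume "l1 < l2"
    with that have "y1 0 < y2 0" by (rule scalar_connector_less)
    moreover have "- pi - y1 (- 0) < - pi - y2 (- 0)"
      using that[THEN scalar_connector_reverse] \<open>l1 < l2\<close> by (rule scalar_connector_less)
    ultimately show False by simp
  qed
  from this[OF assms] this[OF assms(2,1)] show ?thesis by simp
qed

lemma saddles_connector_unique:
  "saddles_connector a E l1 \<Longrightarrow> saddles_connector a E l2 \<Longrightarrow> l1 = l2"
  unfolding saddles_connector_iff using scalar_connector_unique by blast

subsection \<open>Existence of the connector\<close>

text \<open>At \<open>c\<close> the two-sided filter is the supremum of the one-sided ones; any
  other point is interior to one of the half lines.\<close>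

lemma has_real_derivative_glue:
  fixes f :: "real \<Rightarrow> real"
  assumes left: "\<And>t. t \<le> c \<Longrightarrow> (g has_real_derivative f' t) (at t within {..c})"
    and right: "\<And>t. c \<le> t \<Longrightarrow> (h has_real_derivative f' t) (at t within {c..})"
    and f: "\<And>t. t \<le> c \<Longrightarrow> f t = g t" "\<And>t. c \<le> t \<Longrightarrow> f t = h t"
  shows "(f has_real_derivative f' t) (at t)"
proof -
  have L: "(f has_real_derivative f' t) (at t within {..c})" if "t \<le> c" for t
    using has_field_derivative_transform_within[OF left[OF that] zero_less_one] that f(1) by simp
  have R: "(f has_real_derivative f' t) (at t within {c..})" if "c \<le> t" for t
    using has_field_derivative_transform_within[OF right[OF that] zero_less_one] that f(2) by simp
  consider "t < c" | "c < t" | "t = c" by linarith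
  then show ?thesis
  proof cases
    case 1
    then show ?thesis using L[of t] at_within_interior[of t "{..c}"] by simp
  next
    case 2
    then show ?thesis using R[of t] at_within_interior[of t "{c..}"] by simp
  next
    case 3
    have "{..c} \<union> {c..} = UNIV" by auto
    then have "at t = sup (at t within {..c}) (at t within {c..})"
      using at_within_union[of t "{..c}" "{c..}"] by simp
    then show ?thesis
      using L[of t] R[of t] 3 unfolding has_field_derivative_iff by (simp only: filterlim_sup order_refl)
  qed
qed

context theta_flow
begin

context
  fixes E :: real assumes E: "E \<in> {0..1}"
begin

lemma continuous_on_conn_0_1: "continuous_on {0..1} (conn E)"
  unfolding conn_def using mu_unit[OF E] E by (intro continuous_intros) auto

definition left_half :: "real \<Rightarrow> real" where
  "left_half t = - 2 * arctan (conn E (exp t))"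

text \<open>From (x v)' = r follows v' = (r - v)/x, and the substitution \<open>x = exp t\<close>
  cancels the 1/x. The identities for \<open>sin\<close> and \<open>cos\<close> of
  \<open>2 * arctan v\<close> turn the result into \<open>theta_rhs\<close>.\<close>

lemma left_half_deriv:
  assumes "t \<le> 0"
  shows "(left_half has_real_derivative theta_rhs a E (-1 + a * mu E) t (left_half t)) (at t within {..0})"
proof -
  define x where "x = exp t"
  define v where "v = conn E x"
  define r where "r = sn x * riccati a (mu E) E x v"
  have x: "0 < x" "x \<le> 1" using assms by (auto simp: x_def)
  have "((\<lambda>x. x * conn E x / x) has_real_derivative (r * x - x * v * 1) / (x * x)) (at x within {0..1})"
    unfolding r_def v_def using x by (intro DERIV_divide conn_deriv[OF E] DERIV_ident) auto
  then have "(conn E has_real_derivative (r * x - x * v * 1) / (x * x)) (at x within {0..1})"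
    by (rule has_field_derivative_transform_within[OF _ x(1)]) (use x in \<open>auto simp: dist_real_def\<close>)
  moreover have "(r * x - x * v * 1) / (x * x) = (r - v) / x"
    using x by (simp add: field_simps)
  ultimately have "(conn E has_real_derivative (r - v) / x) (at x within {0..1})"
    by simp
  then have "(conn E has_real_derivative (r - v) / x) (at (exp t) within exp ` {..0})"
    unfolding x_def by (rule DERIV_subset) auto
  moreover have "(exp has_real_derivative x) (at t within {..0})"
    unfolding x_def by (rule has_field_derivative_at_within[OF DERIV_exp])
  ultimately have "((\<lambda>t. conn E (exp t)) has_real_derivative r - v) (at t within {..0})"
    using DERIV_image_chain[of "conn E" _ exp] x by (fastforce simp: o_def)
  then have "(left_half has_real_derivative - 2 * (r - v) / (1 + v\<^sup>2)) (at t within {..0})"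
    unfolding left_half_def[abs_def] v_def x_def
    by (auto intro!: derivative_eq_intros simp: field_simps)
  also have "- 2 * (r - v) / (1 + v\<^sup>2) = theta_rhs a E (-1 + a * mu E) t (left_half t)"
  proof -
    have v: "sn v * (1 + v\<^sup>2) = 2 * v" "cs v * (1 + v\<^sup>2) = 1 - v\<^sup>2"
      by (simp_all add: sn_def cs_def)
    have trig: "sin (left_half t) = - sn v" "cos (left_half t) = cs v"
      by (simp_all add: left_half_def sin_2_arctan cos_2_arctan v_def x_def)
    have "theta_rhs a E (-1 + a * mu E) t (left_half t) * (1 + v\<^sup>2)
        = - 2 * a * sn x * cs x * (cs v * (1 + v\<^sup>2)) - 2 * a * E * (sn x)\<^sup>2 * (sn v * (1 + v\<^sup>2))
          + sn v * (1 + v\<^sup>2) + 2 * (-1 + a * mu E) * sn x * (1 + v\<^sup>2)"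
      unfolding theta_rhs_def trig x_def[symmetric] by (simp add: algebra_simps)
    also have "\<dots> = - 2 * (r - v)"
      unfolding v by (simp add: r_def riccati_def algebra_simps power2_eq_square)
    finally show ?thesis by (simp add: nonzero_divide_eq_eq)
  qed
  finally show ?thesis .
qed

text \<open>The right half is the time reversal of the left one. The condition
  \<open>conn E 1 = 1\<close> gives the value -\<pi>/2 at time 0, the fixed point of the reflection,
  so the halves meet.\<close>

lemma scalar_connector_exists:
  "\<exists>y. scalar_connector a E (-1 + a * mu E) y"
proof -
  define y where "y t = (if t \<le> 0 then left_half t else - pi - left_half (- t))" for t
  let ?l = "-1 + a * mu E"
  have mid: "left_half 0 = - (pi / 2)"
    by (simp add: left_half_def conn_at_1[OF E] arctan_one)
  have right: "y t = - pi - left_half (- t)" if "0 \<le> t" for t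
    using that mid by (auto simp: y_def)
  have "(y has_real_derivative theta_rhs a E ?l t (y t)) (at t)" for t
  proof (rule has_real_derivative_glue[where c = 0 and f' = "\<lambda>t. theta_rhs a E ?l t (y t)"])
    show "(left_half has_real_derivative theta_rhs a E ?l t (y t)) (at t within {..0})" if "t \<le> 0" for t
      using left_half_deriv[OF that] that by (simp add: y_def)
    show "((\<lambda>t. - pi - left_half (- t)) has_real_derivative theta_rhs a E ?l t (y t)) (at t within {0..})"
      if "0 \<le> t" for t
      using reverse_deriv[of left_half a E ?l t "{0..}"] left_half_deriv[of "- t"] that
      by (simp add: right)
  qed (auto simp: right, auto simp: y_def)
  moreover have lim: "(left_half \<longlongrightarrow> 0) at_bot"
  proof -
    have "\<forall>\<^sub>F t in at_bot. exp t \<in> {0..1::real}"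
      using eventually_le_at_bot[of 0] by eventually_elim auto
    then have "((\<lambda>t. conn E (exp t)) \<longlongrightarrow> conn E 0) at_bot"
      by (intro continuous_on_tendsto_compose[OF continuous_on_conn_0_1 exp_at_bot]) auto
    then have "((\<lambda>t. - 2 * arctan (conn E (exp t))) \<longlongrightarrow> - 2 * arctan 0) at_bot"
      unfolding conn_at_0[OF E] by (intro tendsto_intros)
    then show ?thesis by (simp add: left_half_def[abs_def])
  qed
  have "(y \<longlongrightarrow> 0) at_bot"
    by (rule Lim_transform_eventually[OF lim])
       (use eventually_le_at_bot[of 0] in eventually_elim, simp add: y_def)
  moreover have "(y \<longlongrightarrow> - pi) at_top"
  proof (rule Lim_transform_eventually)
    have "((\<lambda>t. left_half (- t)) \<longlongrightarrow> 0) at_top"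
      using lim by (simp add: filterlim_at_bot_mirror)
    from tendsto_diff[OF tendsto_const[of "- pi"] this]
    show "((\<lambda>t. - pi - left_half (- t)) \<longlongrightarrow> - pi) at_top" by simp
    show "\<forall>\<^sub>F t in at_top. - pi - left_half (- t) = y t"
      using eventually_ge_at_top[of 0] by eventually_elim (simp add: right)
  qed
  ultimately show ?thesis
    unfolding scalar_connector_def by blast
qed

lemma saddles_connector_mu: "saddles_connector a E (-1 + a * mu E)"
  unfolding saddles_connector_iff by (rule scalar_connector_exists)

end

end

subsection \<open>Dependence on the energy\<close>

lemma integral_pos_of_continuous:
  fixes f :: "real \<Rightarrow> real"
  assumes "continuous_on {0..1} f" "\<And>x. x \<in> {0..1} \<Longrightarrow> 0 \<le> f x" "z \<in> {0..1}" "0 < f z"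
  shows "0 < integral {0..1} f"
proof -
  have "0 \<le> integral {0..1} f"
    using assms by (intro Henstock_Kurzweil_Integration.integral_nonneg integrable_continuous_real) auto
  moreover have "integral {0..1} f \<noteq> 0"
    using integral_eq_0_iff[OF assms(1) _ assms(2)] assms(3,4) by force
  ultimately show ?thesis by simp
qed

context theta_flow
begin

text \<open>The coefficient of the linear equation for the difference of the products x v. The
  factor \<open>2 / (1 + x^2)\<close> is \<open>sn x / x\<close> in a form regular at 0.\<close>

definition slope :: "real \<Rightarrow> real \<Rightarrow> real \<Rightarrow> real" where
  "slope E1 E2 x = 2 / (1 + x\<^sup>2) *
     (2 * a * E1 * sn x + (1 - a * mu E1 - a * cs x) * (conn E2 x + conn E1 x))"

text \<open>The exponential of minus the primitive of \<open>slope\<close>, written over a fixed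
  interval for the sake of joint continuity.\<close>

definition int_factor :: "real \<Rightarrow> real \<Rightarrow> real \<Rightarrow> real" where
  "int_factor E1 E2 x = exp (- (x * integral {0..1} (\<lambda>r. slope E1 E2 (x * r))))"

definition num :: "real \<Rightarrow> real \<Rightarrow> real" where
  "num E1 E2 = integral {0..1} (\<lambda>x. int_factor E1 E2 x * sn x * (2 * sn x * conn E2 x))"

definition den :: "real \<Rightarrow> real \<Rightarrow> real" where
  "den E1 E2 = integral {0..1} (\<lambda>x. int_factor E1 E2 x * sn x * (1 + (conn E2 x)\<^sup>2))"

context
  fixes E1 E2 :: real assumes E1: "E1 \<in> {0..1}" and E2: "E2 \<in> {0..1}"
begin

lemma slope_cont: "continuous_on {0..1} (slope E1 E2)"
  unfolding slope_def by (intro continuous_intros continuous_on_conn_0_1 E1 E2) auto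

lemma int_factor_eq:
  "x \<in> {0..1} \<Longrightarrow> int_factor E1 E2 x = exp (- integral {0..x} (slope E1 E2))"
  unfolding int_factor_def by (subst integral_rescale_unit[OF slope_cont]) auto

lemma int_factor_deriv:
  assumes "x \<in> {0..1}"
  shows "(int_factor E1 E2 has_real_derivative - slope E1 E2 x * int_factor E1 E2 x) (at x within {0..1})"
proof -
  have "((\<lambda>x. exp (- integral {0..x} (slope E1 E2))) has_real_derivative
      exp (- integral {0..x} (slope E1 E2)) * (- slope E1 E2 x)) (at x within {0..1})"
    by (intro DERIV_chain2[OF DERIV_exp] DERIV_minus integral_has_real_derivative[OF slope_cont assms])
  then show ?thesis
    using has_field_derivative_transform_within[OF _ zero_less_one assms] int_factor_eq assms
    by (fastforce simp: mult.commute)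
qed

lemma int_factor_pos: "0 < int_factor E1 E2 x"
  by (simp add: int_factor_def)

lemma int_factor_cont: "continuous_on {0..1} (int_factor E1 E2)"
  using int_factor_deriv by (rule DERIV_continuous_on)

text \<open>The weighted difference \<open>?f\<close> of the two products x v vanishes at 0, where x
  = 0, and at 1, where both connectors equal 1; hence the integral of its derivative is 0.\<close>

lemma num_den: "(E2 - E1) * num E1 E2 = (mu E2 - mu E1) * den E1 E2"
proof -
  let ?J = "int_factor E1 E2"
  let ?f = "\<lambda>x. ?J x * (x * conn E2 x - x * conn E1 x)"
  let ?g1 = "\<lambda>x. ?J x * sn x * (2 * sn x * conn E2 x)"
  let ?g2 = "\<lambda>x. ?J x * sn x * (1 + (conn E2 x)\<^sup>2)"
  have "((\<lambda>x. a * ((E2 - E1) * ?g1 x - (mu E2 - mu E1) * ?g2 x)) has_integral ?f 1 - ?f 0) {0..1}"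
  proof (intro fundamental_theorem_of_calculus)
    fix x :: real assume x: "x \<in> {0..1}"
    have "(?f has_real_derivative ?J x *
        (sn x * riccati a (mu E2) E2 x (conn E2 x) - sn x * riccati a (mu E1) E1 x (conn E1 x))
        + - slope E1 E2 x * ?J x * (x * conn E2 x - x * conn E1 x)) (at x within {0..1})"
      by (intro DERIV_mult' DERIV_diff int_factor_deriv conn_deriv E1 E2 x)
    also have "- slope E1 E2 x * ?J x * (x * conn E2 x - x * conn E1 x)
        = - (?J x * sn x * (riccati a (mu E1) E1 x (conn E2 x) - riccati a (mu E1) E1 x (conn E1 x)))"
    proof -
      define B where "B = 2 * a * E1 * sn x + (1 - a * mu E1 - a * cs x) * (conn E2 x + conn E1 x)"
      define q where "q = 2 / (1 + x\<^sup>2)"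
      have *: "riccati a (mu E1) E1 x (conn E2 x) - riccati a (mu E1) E1 x (conn E1 x)
          = B * (conn E2 x - conn E1 x)"
        by (simp only: riccati_diff B_def)
      have "slope E1 E2 x = q * B" "sn x = q * x"
        by (simp_all only: slope_def B_def q_def sn_def times_divide_eq_left)
      then show ?thesis unfolding * by (simp add: algebra_simps)
    qed
    also have "?J x * (sn x * riccati a (mu E2) E2 x (conn E2 x) - sn x * riccati a (mu E1) E1 x (conn E1 x))
        + - (?J x * sn x * (riccati a (mu E1) E1 x (conn E2 x) - riccati a (mu E1) E1 x (conn E1 x)))
        = ?J x * sn x * (riccati a (mu E2) E2 x (conn E2 x) - riccati a (mu E1) E1 x (conn E2 x))"
      by (simp add: algebra_simps)
    \<comment> \<open>After the cancellation both Riccati terms have the same state, and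
      \<open>riccati\<close> is affine in the two parameters, so this is an identity without
      remainder.\<close>
    also have "riccati a (mu E2) E2 x (conn E2 x) - riccati a (mu E1) E1 x (conn E2 x)
        = a * ((E2 - E1) * (2 * sn x * conn E2 x) - (mu E2 - mu E1) * (1 + (conn E2 x)\<^sup>2))"
      by (simp add: riccati_def algebra_simps)
    also have "?J x * sn x * \<dots> = a * ((E2 - E1) * ?g1 x - (mu E2 - mu E1) * ?g2 x)"
      by (simp add: algebra_simps)
    finally show "(?f has_vector_derivative a * ((E2 - E1) * ?g1 x - (mu E2 - mu E1) * ?g2 x)) (at x within {0..1})"
      by (simp add: has_real_derivative_iff_has_vector_derivative)
  qed simp
  then have "((\<lambda>x. a * ((E2 - E1) * ?g1 x - (mu E2 - mu E1) * ?g2 x)) has_integral 0) {0..1}"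
    by (simp add: conn_at_1[OF E1] conn_at_1[OF E2])
  moreover have "((\<lambda>x. a * ((E2 - E1) * ?g1 x - (mu E2 - mu E1) * ?g2 x)) has_integral
      a * ((E2 - E1) * num E1 E2 - (mu E2 - mu E1) * den E1 E2)) {0..1}"
    unfolding num_def den_def
    by (intro has_integral_mult_right has_integral_diff integrable_integral integrable_continuous_real
        continuous_intros int_factor_cont continuous_on_conn_0_1 E2)
  ultimately have "a * ((E2 - E1) * num E1 E2 - (mu E2 - mu E1) * den E1 E2) = 0"
    by (rule has_integral_unique[rotated])
  then show ?thesis using a by simp
qed

lemma num_pos: "0 < num E1 E2"
  unfolding num_def
proof (rule integral_pos_of_continuous[where z = 1])
  show "0 \<le> int_factor E1 E2 x * sn x * (2 * sn x * conn E2 x)" if "x \<in> {0..1}" for x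
    using that conn_unit[OF E2 that] sn_nonneg[of x] int_factor_pos[of x]
    by (auto intro!: mult_nonneg_nonneg less_imp_le)
qed (auto intro!: continuous_intros int_factor_cont continuous_on_conn_0_1 E2 simp: conn_at_1[OF E2] int_factor_pos)

text \<open>\<open>2 s v \<le> 1 + v\<^sup>2\<close> for \<open>0 \<le> s \<le> 1\<close>, strictly if \<open>s < 1\<close>.\<close>

lemma num_less_den: "num E1 E2 < den E1 E2"
proof -
  let ?g1 = "\<lambda>x. int_factor E1 E2 x * sn x * (2 * sn x * conn E2 x)"
  let ?g2 = "\<lambda>x. int_factor E1 E2 x * sn x * (1 + (conn E2 x)\<^sup>2)"
  have cont: "continuous_on {0..1} ?g1" "continuous_on {0..1} ?g2"
    by (intro continuous_intros int_factor_cont continuous_on_conn_0_1 E2)+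
  have *: "0 < 1 + v\<^sup>2 - 2 * s * v" if "0 \<le> s" "s < 1" "0 \<le> v" for s v :: real
  proof (cases "v = 0")
    case False
    then have "s * v < 1 * v" using that by (intro mult_strict_right_mono) auto
    moreover have "2 * v \<le> 1 + v\<^sup>2"
      using zero_le_power2[of "v - 1"] by (simp add: power2_diff)
    ultimately show ?thesis by simp
  qed simp
  have **: "0 \<le> 1 + v\<^sup>2 - 2 * s * v" if "0 \<le> s" "s \<le> 1" "0 \<le> v" for s v :: real
    using *[of s v] zero_le_power2[of "v - 1"] that by (cases "s = 1") (auto simp: power2_diff)
  have "0 < integral {0..1} (\<lambda>x. ?g2 x - ?g1 x)"
  \<comment> \<open>The integrand vanishes at both ends, since \<open>sn 0 = 0\<close> and
    \<open>sn 1 = conn E2 1 = 1\<close>; strictness is read off at an interior point.\<close>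
  proof (rule integral_pos_of_continuous[where z = "1/2"])
    show "continuous_on {0..1} (\<lambda>x. ?g2 x - ?g1 x)"
      by (intro continuous_on_diff cont)
    have eq: "?g2 x - ?g1 x = int_factor E1 E2 x * sn x * (1 + (conn E2 x)\<^sup>2 - 2 * sn x * conn E2 x)" for x
      by (simp add: algebra_simps)
    show "0 \<le> ?g2 x - ?g1 x" if "x \<in> {0..1}" for x
      unfolding eq using that conn_unit[OF E2 that] sn_nonneg[of x] sn_le_1[of x] int_factor_pos[of x]
      by (auto intro!: mult_nonneg_nonneg ** less_imp_le[OF int_factor_pos])
    have "sn (1/2) = 4/5" by (simp add: sn_def power2_eq_square)
    then show "0 < ?g2 (1/2) - ?g1 (1/2)"
      unfolding eq using conn_unit[OF E2, of "1/2"] *[of "sn (1/2)" "conn E2 (1/2)"] int_factor_pos[of "1/2"]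
      by auto
  qed simp
  also have "\<dots> = den E1 E2 - num E1 E2"
    unfolding num_def den_def by (intro integral_diff integrable_continuous_real cont)
  finally show ?thesis by simp
qed

lemma mu_diff: "mu E2 - mu E1 = num E1 E2 / den E1 E2 * (E2 - E1)"
  using num_den num_pos num_less_den by (simp add: field_simps)

lemma quotient_bounds: "0 < num E1 E2 / den E1 E2" "num E1 E2 / den E1 E2 < 1"
  using num_pos num_less_den by simp_all

end

section \<open>Continuous differentiability of \<open>mu\<close>\<close>

text \<open>The quotient in \<open>mu_diff\<close> lies in (0, 1), so \<open>mu\<close> is Lipschitz
  with constant 1. This comes before any continuity of the quotient itself, whose ingredients
  contain \<open>mu\<close>.\<close>

lemma continuous_on_mu: "continuous_on {0..1} mu"
proof (rule continuous_onI)
  fix x e :: real assume x: "x \<in> {0..1}" and e: "0 < e"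
  have "dist (mu y) (mu x) \<le> dist y x" if y: "y \<in> {0..1}" for y
    unfolding dist_real_def mu_diff[OF x y] abs_mult
    using quotient_bounds[OF x y] by (intro mult_left_le_one_le) auto
  with e show "\<exists>d>0. \<forall>x'\<in>{0..1}. dist x' x < d \<longrightarrow> dist (mu x') (mu x) \<le> e"
    by (meson less_imp_le order_trans)
qed

lemma continuous_on_mu_compose [continuous_intros]:
  assumes "continuous_on A f" "\<And>p. p \<in> A \<Longrightarrow> f p \<in> {0..1}"
  shows "continuous_on A (\<lambda>p. mu (f p))"
  using assms by (intro continuous_on_compose2[OF continuous_on_mu]) auto

lemma continuous_on_conn [continuous_intros]:
  assumes "continuous_on A f" "continuous_on A g" "\<And>p. p \<in> A \<Longrightarrow> f p \<in> {0..1} \<and> g p \<in> {0..1}"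
  shows "continuous_on A (\<lambda>p. conn (f p) (g p))"
  unfolding conn_def using assms mu_unit by (intro continuous_intros) auto

lemma continuous_on_slope:
  assumes "continuous_on A f" "continuous_on A g" "continuous_on A h"
    "\<And>p. p \<in> A \<Longrightarrow> f p \<in> {0..1} \<and> g p \<in> {0..1} \<and> h p \<in> {0..1}"
  shows "continuous_on A (\<lambda>p. slope (f p) (g p) (h p))"
  unfolding slope_def by (intro continuous_intros assms) (use assms(4) in auto)

lemma continuous_on_int_factor:
  "continuous_on ({0..1} \<times> {0..1} \<times> {0..1}) (\<lambda>(E1, E2, x). int_factor E1 E2 x)"
proof -
  have "continuous_on ({0..1} \<times> {0..1} \<times> {0..1})
      (\<lambda>p. integral (cbox 0 1) (\<lambda>r. slope (fst p) (fst (snd p)) (snd (snd p) * r)))"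
    by (rule integral_continuous_on_param, unfold split_beta, rule continuous_on_slope)
       (auto intro!: continuous_intros intro: mult_le_one)
  then show ?thesis
    unfolding int_factor_def split_beta by (intro continuous_intros) simp
qed

lemma continuous_on_quotient:
  "continuous_on ({0..1} \<times> {0..1}) (\<lambda>(E1, E2). num E1 E2 / den E1 E2)"
proof -
  have J: "continuous_on (({0..1} \<times> {0..1}) \<times> {0..1}) (\<lambda>q. int_factor (fst (fst q)) (snd (fst q)) (snd q))"
    using continuous_on_compose2[OF continuous_on_int_factor, of "({0..1} \<times> {0..1}) \<times> {0..1}" "\<lambda>q. (fst (fst q), snd (fst q), snd q)"]
    by (force intro: continuous_intros)
  have "continuous_on ({0..1} \<times> {0..1}) (\<lambda>p. integral (cbox 0 1)
      (\<lambda>x. int_factor (fst p) (snd p) x * sn x * (2 * sn x * conn (snd p) x)))"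
    and "continuous_on ({0..1} \<times> {0..1}) (\<lambda>p. integral (cbox 0 1)
      (\<lambda>x. int_factor (fst p) (snd p) x * sn x * (1 + (conn (snd p) x)\<^sup>2)))"
    by ((rule integral_continuous_on_param, unfold split_beta, intro continuous_intros; use J in auto)[])+
  then show ?thesis
    unfolding num_def den_def split_beta
  proof (intro continuous_on_divide ballI)
    fix p :: "real \<times> real" assume "p \<in> {0..1} \<times> {0..1}"
    then have "0 < den (fst p) (snd p)"
      using num_pos[of "fst p" "snd p"] num_less_den[of "fst p" "snd p"] by auto
    then show "integral {0..1} (\<lambda>x. int_factor (fst p) (snd p) x * sn x * (1 + (conn (snd p) x)\<^sup>2)) \<noteq> 0"
      by (simp add: den_def)
  qed simp_all
qed

text \<open>By \<open>mu_diff\<close> the difference quotient of \<open>mu\<close> is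
  \<open>num E y / den E y\<close>, which is continuous at \<open>y = E\<close>.\<close>

lemma mu_deriv:
  assumes E: "E \<in> {0..1}"
  shows "(mu has_real_derivative num E E / den E E) (at E within {0..1})"
proof -
  have "continuous_on {0..1} (\<lambda>y. num E y / den E y)"
    using continuous_on_compose2[OF continuous_on_quotient, of "{0..1}" "\<lambda>y. (E, y)"] E
    by (force intro: continuous_intros)
  then have "((\<lambda>y. num E y / den E y) \<longlongrightarrow> num E E / den E E) (at E within {0..1})"
    using E by (simp add: continuous_on)
  then have "((\<lambda>y. (mu y - mu E) / (y - E)) \<longlongrightarrow> num E E / den E E) (at E within {0..1})"
    by (rule Lim_transform_eventually) (auto simp: eventually_at_filter mu_diff[OF E])
  then show ?thesis
    by (simp add: has_field_derivative_iff)
qed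

lemma continuous_on_mu_deriv: "continuous_on {0..1} (\<lambda>E. num E E / den E E)"
  using continuous_on_compose2[OF continuous_on_quotient, of "{0..1}" "\<lambda>y. (y, y)"]
  by (force intro: continuous_intros)

lemma mu_strict_mono: "E1 \<in> {0..1} \<Longrightarrow> E2 \<in> {0..1} \<Longrightarrow> E1 < E2 \<Longrightarrow> mu E1 < mu E2"
  using mu_diff[of E1 E2] quotient_bounds[of E1 E2] by (metis diff_gt_0_iff_gt mult_pos_pos)

end

section \<open>Transfer from \<open>mu\<close> to \<Lambda> by the affine change of
  parameter\<close>

theorem theorem7:
  fixes a :: real
  assumes "0 < a" and "a < 1/2"
  shows "\<exists>\<Lambda> :: real \<Rightarrow> real.
           (\<forall>E \<in> {0..1}. \<Lambda> E \<in> {-1-a .. -1+a} \<and> saddles_connector a E (\<Lambda> E) \<and>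
              (\<forall>lam \<in> {-1-a .. -1+a}. saddles_connector a E lam \<longrightarrow> lam = \<Lambda> E)) \<and>
           strict_mono_on {0..1} \<Lambda> \<and>
           (\<exists>\<Lambda>'. continuous_on {0..1} \<Lambda>' \<and>
              (\<forall>E \<in> {0..1}. (\<Lambda> has_real_derivative \<Lambda>' E) (at E within {0..1}) \<and> \<Lambda>' E < a))"
proof -
  interpret theta_flow a
    by unfold_locales (use assms in auto)
  define \<Lambda> where "\<Lambda> E = - 1 + a * mu E" for E
  define \<Lambda>' where "\<Lambda>' E = a * (num E E / den E E)" for E
  have range: "\<Lambda> E \<in> {-1-a .. -1+a}" if "E \<in> {0..1}" for E
  proof -
    have "0 \<le> a * mu E" "a * mu E \<le> a * 1"
      using mu_unit[OF that] a by (auto intro: mult_left_mono)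
    then show ?thesis using a by (simp add: \<Lambda>_def)
  qed
  have conn: "saddles_connector a E (\<Lambda> E)" if "E \<in> {0..1}" for E
    unfolding \<Lambda>_def using that by (rule saddles_connector_mu)
  have deriv: "(\<Lambda> has_real_derivative \<Lambda>' E) (at E within {0..1})" if "E \<in> {0..1}" for E
    unfolding \<Lambda>_def \<Lambda>'_def
    by (rule DERIV_cong[OF DERIV_add[OF DERIV_const DERIV_cmult[OF mu_deriv[OF that]]]]) simp
  have less: "\<Lambda>' E < a" if "E \<in> {0..1}" for E
    using mult_strict_left_mono[OF quotient_bounds(2)[OF that that] a(1)] by (simp add: \<Lambda>'_def)
  show ?thesis
  proof (intro exI conjI ballI impI)
    show "strict_mono_on {0..1} \<Lambda>"
      by (rule strict_mono_onI) (simp add: \<Lambda>_def mu_strict_mono a)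
    show "continuous_on {0..1} \<Lambda>'"
      unfolding \<Lambda>'_def by (intro continuous_on_mult continuous_on_const continuous_on_mu_deriv)
    show "lam = \<Lambda> E" if "E \<in> {0..1}" "saddles_connector a E lam" for E lam
      using that(2) conn[OF that(1)] by (rule saddles_connector_unique)
  qed (fact range conn deriv less)+
qed

end
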